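(* Let $K$ be a field and let $B$ be the set of bases of a discrete polymatroid $P\subset\mathbb{Z}_+^n$. Then the base ring $K[B]$ is normal.
   Context: $[n]=\{1,\dots,n\}$; $\mathbb{Z}_+^n$ is the set of integer vectors with nonnegative entries. $|u|=\sum_iu(i)$. $u\le v$ is the componentwise order; $u<v$ means $u\le v$, $u\neq v$; $u\vee v$ is the componentwise maximum. A discrete polymatroid on $[n]$ is a nonempty finite set $P\subset\mathbb{Z}_+^n$ such that (D1) if $u\in P$, $v\in\mathbb{Z}_+^n$ and $v\le u$, then $v\in P$; (D2) if $u,v\in P$ with $|v|>|u|$, then there is $w\in P$ with $u<w\le u\vee v$. A base of $P$ is a vector $u\in P$ with $u<v$ for no $v\in P$. With $t^u=t_1^{u(1)}\cdots t_n^{u(n)}$, the base ring is $K[B]=K[t^us: u\in B]\subset K[t_1,\dots,t_n,s]$. Normal means integrally closed in its field of fractions. *)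

theory Defs
  imports
    "HOL-Library.Poly_Mapping"
    "HOL-Computational_Algebra.Polynomial"
    "HOL-Computational_Algebra.Fraction_Field"
begin

section \<open>Discrete polymatroids\<close>

text \<open>
  A vector in \<open>\<int>\<^sub>+\<^sup>n\<close> is a function \<open>nat \<Rightarrow> nat\<close> vanishing outside \<open>{1..n}\<close>. The library's pointwise
  \<open>\<le>\<close>, \<open><\<close> and \<open>sup\<close> on functions are then the componentwise order, its strict part and the
  componentwise maximum.
\<close>

definition nonneg_vectors :: "nat \<Rightarrow> (nat \<Rightarrow> nat) set" where
  "nonneg_vectors n = {u. \<forall>i. i \<notin> {1..n} \<longrightarrow> u i = 0}"

definition modulus :: "nat \<Rightarrow> (nat \<Rightarrow> nat) \<Rightarrow> nat" where
  "modulus n u = (\<Sum>i=1..n. u i)"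

definition discrete_polymatroid :: "nat \<Rightarrow> (nat \<Rightarrow> nat) set \<Rightarrow> bool" where
  "discrete_polymatroid n P \<longleftrightarrow>
     P \<noteq> {} \<and> finite P \<and> P \<subseteq> nonneg_vectors n \<and>
     (\<forall>u\<in>P. \<forall>v\<in>nonneg_vectors n. v \<le> u \<longrightarrow> v \<in> P) \<and>
     (\<forall>u\<in>P. \<forall>v\<in>P. modulus n v > modulus n u \<longrightarrow> (\<exists>w\<in>P. u < w \<and> w \<le> sup u v))"

definition bases :: "(nat \<Rightarrow> nat) set \<Rightarrow> (nat \<Rightarrow> nat) set" where
  "bases P = {u \<in> P. \<not> (\<exists>v\<in>P. u < v)}"


section \<open>The base ring\<close>

text \<open>
  Polynomials over \<open>K\<close> in variables indexed by \<open>nat\<close>: an exponent vector is a finitely supported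
  map \<open>nat \<Rightarrow>\<^sub>0 nat\<close>, and a polynomial is a finitely supported map from exponent vectors to \<open>K\<close>.
  Variable \<open>0\<close> plays the role of \<open>s\<close> and variable \<open>i \<in> {1..n}\<close> that of \<open>t\<^sub>i\<close>; the remaining variables
  do not occur in the base ring, which thus lies in \<open>K[t\<^sub>1, \<dots>, t\<^sub>n, s]\<close>.
\<close>

type_synonym 'k mpoly = "(nat \<Rightarrow>\<^sub>0 nat) \<Rightarrow>\<^sub>0 'k"

definition mconst :: "'k::field \<Rightarrow> 'k mpoly" where
  "mconst c = Poly_Mapping.single 0 c"

definition mvar :: "nat \<Rightarrow> 'k::field mpoly" where
  "mvar i = Poly_Mapping.single (Poly_Mapping.single i 1) 1"

inductive_set subalgebra_generated :: "'k::field mpoly set \<Rightarrow> 'k mpoly set"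
  for G :: "'k mpoly set" where
  const: "mconst c \<in> subalgebra_generated G"
| gen: "g \<in> G \<Longrightarrow> g \<in> subalgebra_generated G"
| add: "f \<in> subalgebra_generated G \<Longrightarrow> g \<in> subalgebra_generated G
          \<Longrightarrow> f + g \<in> subalgebra_generated G"
| mult: "f \<in> subalgebra_generated G \<Longrightarrow> g \<in> subalgebra_generated G
          \<Longrightarrow> f * g \<in> subalgebra_generated G"

definition base_ring :: "nat \<Rightarrow> (nat \<Rightarrow> nat) set \<Rightarrow> 'k::field mpoly set" where
  "base_ring n B = subalgebra_generated ((\<lambda>u. (\<Prod>i=1..n. mvar i ^ u i) * mvar 0) ` B)"


section \<open>Normality\<close>

text \<open>
  A domain is given as a subring \<open>R\<close> of an ambient integral domain. Its field of fractions is
  realised inside the fraction field of the ambient domain, with \<open>a \<in> R\<close> identified with \<open>a / 1\<close>.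
\<close>

definition embed_fract :: "'a::idom \<Rightarrow> 'a fract" where
  "embed_fract a = Fract a 1"

definition fraction_field_of :: "'a::idom set \<Rightarrow> 'a fract set" where
  "fraction_field_of R = {Fract a b | a b. a \<in> R \<and> b \<in> R \<and> b \<noteq> 0}"

definition integral_over :: "'a::comm_ring_1 set \<Rightarrow> 'a \<Rightarrow> bool" where
  "integral_over R x \<longleftrightarrow>
     (\<exists>p. lead_coeff p = 1 \<and> (\<forall>i. coeff p i \<in> R) \<and> poly p x = 0)"

definition normal_domain :: "'a::idom set \<Rightarrow> bool" where
  "normal_domain R \<longleftrightarrow>
     (\<forall>x\<in>fraction_field_of R. integral_over (embed_fract ` R) x \<longrightarrow> x \<in> embed_fract ` R)"

end

theory Submission
  imports Defs
begin

text \<open>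
  The proof has a combinatorial half and an algebraic half, joined by a set of exponents.

  Let \<open>\<rho>(A)\<close> be the largest value of \<open>u(A) = (\<Sum>i\<in>A. u(i))\<close> for \<open>u \<in> P\<close>, and let \<open>C\<close> be the set of all
  \<open>(w, q)\<close> with \<open>w(A) \<le> q \<rho>(A)\<close> for all \<open>A \<subseteq> [n]\<close> and equality for \<open>A = [n]\<close>, where \<open>w\<close> is a nonnegative integer
  vector and \<open>q\<close> a natural number. The base ring is the monoid algebra \<open>K[C]\<close>
  (\<open>base_ring_eq_monoid_algebra\<close>). The point is that every \<open>(w, q) \<in> C\<close> is a sum of \<open>q\<close> vectors \<open>(u, 1)\<close> with \<open>u\<close> a base
  (\<open>base_split\<close>). Indeed \<open>\<rho>\<close> is submodular (\<open>polymatroid_rank_submodular\<close>), an integer vector below a sum of two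
  submodular functions splits into integer vectors below the summands (\<open>submodular_decomposition\<close>), and
  the nonnegative integer vectors below \<open>\<rho>\<close> are exactly the members of \<open>P\<close> (\<open>in_polymatroid_if_sum_le_rank\<close>).

  Since \<open>C\<close> is cut out by homogeneous linear inequalities, it is completely integrally closed: if \<open>x, y, z \<in> C\<close> and
  \<open>z + i (x - y) \<in> C\<close> for all \<open>i\<close>, then \<open>x - y \<in> C\<close> (\<open>base_cone_completely_closed\<close>). This property passes from
  \<open>C\<close> to \<open>K[C]\<close>. If \<open>f / g\<close> is integral over \<open>K[C]\<close>, its powers have a common denominator \<open>d\<close>
  (\<open>integral_imp_almost_integral\<close>). Leading exponents for a monomial order then satisfy the condition
  above, so \<open>C\<close> contains the difference of the leading exponents of \<open>f\<close> and \<open>g\<close>. Subtracting the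
  corresponding monomial from \<open>f / g\<close> lowers the leading exponent of the numerator and
  keeps the common denominator; after finitely many such steps \<open>f / g\<close> is written as an element of \<open>K[C]\<close>
  (\<open>almost_integral_quotient_in_monoid_algebra\<close>).
\<close>

section \<open>Splitting integer vectors below sums of submodular functions\<close>

text \<open>
  If \<open>f\<close> bounds the sums \<open>u(A)\<close> of a vector with \<open>u(j) = a\<close>, then \<open>f'\<close> is the bound that remains for the
  other coordinates, since \<open>A\<close> may be used with or without \<open>j\<close>. Each of the four combinations
  of the two minima on the right is submodularity of \<open>f\<close> at sets with or without \<open>j\<close>.
\<close>
lemma submodular_slice:
  fixes f :: "'a set \<Rightarrow> int"
  assumes sub: "\<And>A B. A \<subseteq> insert j E \<Longrightarrow> B \<subseteq> insert j E \<Longrightarrow> f (A \<union> B) + f (A \<inter> B) \<le> f A + f B"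
    and AB: "A \<subseteq> E" "B \<subseteq> E" and j: "j \<notin> E"
    and f': "f' = (\<lambda>A. min (f A) (f (insert j A) - a))"
  shows "f' (A \<union> B) + f' (A \<inter> B) \<le> f' A + f' B"
proof -
  have "j \<notin> A" "j \<notin> B" using AB j by auto
  have "f (A \<union> B) + f (A \<inter> B) \<le> f A + f B"
    using sub AB by blast
  moreover have "f (insert j (A \<union> B)) + f (A \<inter> B) \<le> f A + f (insert j B)"
    using sub[of A "insert j B"] AB \<open>j \<notin> A\<close> by auto
  moreover have "f (insert j (A \<union> B)) + f (A \<inter> B) \<le> f (insert j A) + f B"
    using sub[of "insert j A" B] AB \<open>j \<notin> B\<close> by auto
  moreover have "f (insert j (A \<union> B)) + f (insert j (A \<inter> B)) \<le> f (insert j A) + f (insert j B)"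
  proof -
    have "insert j A \<union> insert j B = insert j (A \<union> B)" "insert j A \<inter> insert j B = insert j (A \<inter> B)"
      by auto
    then show ?thesis using sub[of "insert j A" "insert j B"] AB by (metis insert_mono)
  qed
  ultimately show ?thesis unfolding f' by (simp add: min_def)
qed

text \<open>
  Integer vectors below a sum of two submodular functions split into integer vectors below the
  summands. The splitting is found one coordinate at a time. Giving the share \<open>a\<close> of \<open>w(j)\<close> to \<open>f\<close>
  leaves a problem of the same kind for the slices of \<open>f\<close> and \<open>g\<close>, and that problem is solvable as
  soon as \<open>a\<close> lies above every \<open>w(B \<union> {j}) - f(B) - g(B \<union> {j})\<close> and below every
  \<open>f(A \<union> {j}) + g(A) - w(A)\<close>. Each lower bound is at most each upper bound: adding
  submodularity of \<open>f\<close> for the pair \<open>A \<union> {j}\<close>, \<open>B\<close> to that of \<open>g\<close> for the pair \<open>A\<close>, \<open>B \<union> {j}\<close>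
  reduces the comparison to the hypothesis on \<open>w\<close> at \<open>A \<inter> B\<close> and \<open>A \<union> B \<union> {j}\<close>. All bounds are integers,
  so an integral \<open>a\<close> exists.
\<close>
lemma submodular_decomposition:
  fixes f g :: "'a set \<Rightarrow> int" and w :: "'a \<Rightarrow> int"
  assumes "finite E"
    and "f {} = 0" "g {} = 0"
    and "\<And>A B. A \<subseteq> B \<Longrightarrow> B \<subseteq> E \<Longrightarrow> f A \<le> f B"
    and "\<And>A B. A \<subseteq> B \<Longrightarrow> B \<subseteq> E \<Longrightarrow> g A \<le> g B"
    and "\<And>A B. A \<subseteq> E \<Longrightarrow> B \<subseteq> E \<Longrightarrow> f (A \<union> B) + f (A \<inter> B) \<le> f A + f B"
    and "\<And>A B. A \<subseteq> E \<Longrightarrow> B \<subseteq> E \<Longrightarrow> g (A \<union> B) + g (A \<inter> B) \<le> g A + g B"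
    and "\<And>i. i \<in> E \<Longrightarrow> 0 \<le> w i"
    and "\<And>A. A \<subseteq> E \<Longrightarrow> sum w A \<le> f A + g A"
  shows "\<exists>u. (\<forall>i\<in>E. 0 \<le> u i \<and> u i \<le> w i) \<and>
             (\<forall>A\<subseteq>E. sum u A \<le> f A \<and> sum (\<lambda>i. w i - u i) A \<le> g A)"
  using assms
proof (induction E arbitrary: f g rule: finite_induct)
  case empty
  then show ?case by auto
next
  case (insert j E)
  note fmono = insert.prems(3) and gmono = insert.prems(4)
  note fsub = insert.prems(5) and gsub = insert.prems(6)
  note wnn = insert.prems(7) and wle = insert.prems(8)
  \<comment> \<open>The least admissible share of coordinate \<open>j\<close>; the element 0 of \<open>L\<close> keeps the share nonnegative.\<close>
  define L where "L = insert 0 ((\<lambda>B. sum w (insert j B) - f B - g (insert j B)) ` Pow E)"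
  define a where "a = Max L"
  have finL: "finite L" "L \<noteq> {}" using insert.hyps(1) by (auto simp: L_def)
  have sumj: "sum w (insert j A) = w j + sum w A" if "A \<subseteq> E" for A
    using that insert.hyps by (meson finite_subset subsetD sum.insert)
  have a_low: "sum w (insert j A) - f A - g (insert j A) \<le> a" if "A \<subseteq> E" for A
    unfolding a_def using finL that by (intro Max_ge) (auto simp: L_def)
  have a0: "0 \<le> a" unfolding a_def using finL by (intro Max_ge) (auto simp: L_def)
  have a_up: "a \<le> f (insert j A) + g A - sum w A" if A: "A \<subseteq> E" for A
    unfolding a_def
  proof (rule Max.boundedI[OF finL])
    fix l assume "l \<in> L"
    then consider "l = 0" | B where "B \<subseteq> E" "l = sum w (insert j B) - f B - g (insert j B)"
      unfolding L_def by auto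
    then show "l \<le> f (insert j A) + g A - sum w A"
    proof cases
      case 1
      have "f A \<le> f (insert j A)" using fmono[of A "insert j A"] A by auto
      moreover have "sum w A \<le> f A + g A" using wle A by blast
      ultimately show ?thesis using 1 by linarith
    next
      case 2
      have jn: "j \<notin> A" "j \<notin> B" using A 2 insert.hyps by auto
      have fin: "finite A" "finite B" using A 2 insert.hyps finite_subset by auto
      have "f (insert j (A \<union> B)) + f (A \<inter> B) \<le> f (insert j A) + f B"
        using fsub[of "insert j A" B] A 2(1) jn by auto
      moreover have "g (insert j (A \<union> B)) + g (A \<inter> B) \<le> g A + g (insert j B)"
        using gsub[of A "insert j B"] A 2(1) jn by auto
      moreover have "sum w (insert j (A \<union> B)) \<le> f (insert j (A \<union> B)) + g (insert j (A \<union> B))"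
        using wle[of "insert j (A \<union> B)"] A 2(1) by auto
      moreover have "sum w (A \<inter> B) \<le> f (A \<inter> B) + g (A \<inter> B)"
        using wle[of "A \<inter> B"] A by auto
      moreover have "sum w (insert j (A \<union> B)) + sum w (A \<inter> B) = sum w A + sum w (insert j B)"
        using sumj[of "A \<union> B"] sumj[of B] A 2(1) sum.union_inter[OF fin, of w] by auto
      ultimately show ?thesis using 2(2) by linarith
    qed
  qed
  have aw: "a \<le> w j"
    unfolding a_def
  proof (rule Max.boundedI[OF finL])
    fix l assume "l \<in> L"
    then consider "l = 0" | B where "B \<subseteq> E" "l = sum w (insert j B) - f B - g (insert j B)"
      unfolding L_def by auto
    then show "l \<le> w j"
    proof cases
      case 1 then show ?thesis using wnn by auto
    next
      case 2
      have "sum w B \<le> f B + g B" using wle 2(1) by auto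
      moreover have "g B \<le> g (insert j B)" using gmono[of B "insert j B"] 2(1) by auto
      ultimately show ?thesis using sumj 2 by auto
    qed
  qed
  define f' where "f' = (\<lambda>A. min (f A) (f (insert j A) - a))"
  define g' where "g' = (\<lambda>A. min (g A) (g (insert j A) - (w j - a)))"
  have "\<exists>u. (\<forall>i\<in>E. 0 \<le> u i \<and> u i \<le> w i) \<and>
             (\<forall>A\<subseteq>E. sum u A \<le> f' A \<and> sum (\<lambda>i. w i - u i) A \<le> g' A)"
  proof (rule insert.IH)
    show "f' {} = 0" using a_up[of "{}"] insert.prems(1,2) by (simp add: f'_def)
    show "g' {} = 0" using a_low[of "{}"] insert.prems(1,2) by (simp add: g'_def)
    show "f' A \<le> f' B" if "A \<subseteq> B" "B \<subseteq> E" for A B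
      using fmono[of A B] fmono[of "insert j A" "insert j B"] that
      unfolding f'_def min_def by (smt (verit) insert_mono subset_insertI2)
    show "g' A \<le> g' B" if "A \<subseteq> B" "B \<subseteq> E" for A B
      using gmono[of A B] gmono[of "insert j A" "insert j B"] that
      unfolding g'_def min_def by (smt (verit) insert_mono subset_insertI2)
    show "f' (A \<union> B) + f' (A \<inter> B) \<le> f' A + f' B" if "A \<subseteq> E" "B \<subseteq> E" for A B
      using submodular_slice[OF fsub that insert.hyps(2) f'_def] by blast
    show "g' (A \<union> B) + g' (A \<inter> B) \<le> g' A + g' B" if "A \<subseteq> E" "B \<subseteq> E" for A B
      using submodular_slice[OF gsub that insert.hyps(2) g'_def] by blast
    show "0 \<le> w i" if "i \<in> E" for i using wnn that by auto
    show "sum w A \<le> f' A + g' A" if A: "A \<subseteq> E" for A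
    proof -
      have "sum w A \<le> f A + g A" using wle A by blast
      moreover have "sum w (insert j A) \<le> f (insert j A) + g (insert j A)"
        using wle[of "insert j A"] A by blast
      ultimately show ?thesis
        using a_low[OF A] a_up[OF A] sumj[OF A] unfolding f'_def g'_def min_def by auto
    qed
  qed
  then obtain u where u: "\<And>i. i \<in> E \<Longrightarrow> 0 \<le> u i \<and> u i \<le> w i"
    "\<And>A. A \<subseteq> E \<Longrightarrow> sum u A \<le> f' A \<and> sum (\<lambda>i. w i - u i) A \<le> g' A" by blast
  define v where "v = u(j := a)"
  have "0 \<le> v i \<and> v i \<le> w i" if "i \<in> insert j E" for i
    using that u(1) a0 aw by (auto simp: v_def)
  moreover have "sum v A \<le> f A \<and> sum (\<lambda>i. w i - v i) A \<le> g A" if A: "A \<subseteq> insert j E" for A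
  proof -
    define A' where "A' = A - {j}"
    have A': "A' \<subseteq> E" "finite A'" using A insert.hyps(1) by (auto simp: A'_def intro: finite_subset)
    have eq: "sum v A' = sum u A'" "sum (\<lambda>i. w i - v i) A' = sum (\<lambda>i. w i - u i) A'"
      by (auto intro!: sum.cong simp: v_def A'_def)
    have le: "sum u A' \<le> f' A'" "sum (\<lambda>i. w i - u i) A' \<le> g' A'" using u(2)[OF A'(1)] by auto
    show ?thesis
    proof (cases "j \<in> A")
      case False
      then have "A' = A" by (auto simp: A'_def)
      then show ?thesis using eq le by (simp add: f'_def g'_def)
    next
      case True
      then have Aeq: "A = insert j A'" by (auto simp: A'_def)
      have "j \<notin> A'" by (simp add: A'_def)
      have "sum v A = a + sum u A'" "sum (\<lambda>i. w i - v i) A = (w j - a) + sum (\<lambda>i. w i - u i) A'"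
        unfolding Aeq using \<open>j \<notin> A'\<close> A'(2) eq by (auto simp: v_def)
      then show ?thesis using le Aeq by (auto simp: f'_def g'_def)
    qed
  qed
  ultimately show ?case by blast
qed

section \<open>The rank function of a discrete polymatroid\<close>

definition polymatroid_rank :: "(nat \<Rightarrow> nat) set \<Rightarrow> nat set \<Rightarrow> nat" where
  "polymatroid_rank P A = Max ((\<lambda>u. sum u A) ` P)"

lemma fun_less_iff_nat:
  fixes u w :: "nat \<Rightarrow> nat"
  shows "u < w \<longleftrightarrow> u \<le> w \<and> (\<exists>i. u i < w i)"
  unfolding less_le_not_le[of u w] by (auto simp: le_fun_def not_le)

lemma modulus_strict_mono:
  assumes "u \<in> nonneg_vectors n" "w \<in> nonneg_vectors n" "u < w"
  shows "modulus n u < modulus n w"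
proof -
  obtain i where i: "u i < w i" using assms(3) by (auto simp: fun_less_iff_nat)
  then have "i \<in> {1..n}" using assms(2) by (auto simp: nonneg_vectors_def)
  then show ?thesis unfolding modulus_def
    using assms(3) i by (intro sum_strict_mono_ex1) (auto simp: fun_less_iff_nat le_fun_def)
qed

context
  fixes n :: nat and P :: "(nat \<Rightarrow> nat) set"
  assumes dp: "discrete_polymatroid n P"
begin

lemma polymatroid_finite: "finite P" and polymatroid_nonempty: "P \<noteq> {}"
  using dp by (simp_all add: discrete_polymatroid_def)

lemma polymatroid_support: "u \<in> P \<Longrightarrow> u \<in> nonneg_vectors n"
  using dp unfolding discrete_polymatroid_def by (meson subsetD)

lemma polymatroid_exchange:
  assumes "u \<in> P" "v \<in> P" "modulus n u < modulus n v"
  shows "\<exists>w\<in>P. u < w \<and> w \<le> sup u v"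
proof -
  have "\<forall>u\<in>P. \<forall>v\<in>P. modulus n v > modulus n u \<longrightarrow> (\<exists>w\<in>P. u < w \<and> w \<le> sup u v)"
    using dp unfolding discrete_polymatroid_def by (elim conjE)
  from this[rule_format, OF assms] show ?thesis .
qed

lemma polymatroid_downward:
  assumes "u \<in> P" "v \<le> u" shows "v \<in> P"
proof -
  have "v i = 0" if "i \<notin> {1..n}" for i
    using le_funD[OF assms(2), of i] polymatroid_support[OF assms(1)] that
    by (simp add: nonneg_vectors_def)
  then have "v \<in> nonneg_vectors n" by (simp add: nonneg_vectors_def)
  moreover have "\<forall>u\<in>P. \<forall>v\<in>nonneg_vectors n. v \<le> u \<longrightarrow> v \<in> P"
    using dp unfolding discrete_polymatroid_def by (elim conjE)
  ultimately show ?thesis using assms by simp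
qed

lemma sum_le_polymatroid_rank: "u \<in> P \<Longrightarrow> sum u A \<le> polymatroid_rank P A"
  unfolding polymatroid_rank_def using polymatroid_finite by auto

lemma polymatroid_rank_attained:
  assumes "finite A"
  shows "\<exists>u\<in>P. (\<forall>i. i \<notin> A \<longrightarrow> u i = 0) \<and> sum u A = polymatroid_rank P A"
proof -
  have "polymatroid_rank P A \<in> (\<lambda>u. sum u A) ` P"
    unfolding polymatroid_rank_def using polymatroid_finite polymatroid_nonempty by (intro Max_in) auto
  then obtain u where u: "u \<in> P" "sum u A = polymatroid_rank P A" by auto
  define v where "v = (\<lambda>i. if i \<in> A then u i else 0)"
  have "v \<in> P" using polymatroid_downward[OF u(1)] by (auto simp: v_def le_fun_def)
  moreover have "sum v A = polymatroid_rank P A" using u(2) by (simp add: v_def cong: sum.cong)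
  ultimately show ?thesis by (auto simp: v_def intro!: bexI[of _ v])
qed

lemma polymatroid_rank_mono:
  assumes "A \<subseteq> B" "finite B"
  shows "polymatroid_rank P A \<le> polymatroid_rank P B"
proof -
  obtain u where "u \<in> P" "sum u A = polymatroid_rank P A"
    using polymatroid_rank_attained assms finite_subset by metis
  then show ?thesis
    using sum_le_polymatroid_rank[of u B] sum_mono2[OF assms(2,1), of u] by auto
qed

lemma polymatroid_rank_empty: "polymatroid_rank P {} = 0"
  using polymatroid_rank_attained[of "{}"] by auto

text \<open>
  Below a fixed vector \<open>c\<close>, every member of \<open>P\<close> extends to one whose modulus is the largest possible
  below \<open>c\<close>. An extension of largest modulus among all extensions will do: the exchange axiom would
  enlarge it further, still below \<open>c\<close>, if another member below \<open>c\<close> had larger modulus.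
\<close>
lemma maximal_extension:
  assumes "z \<in> P" "z \<le> c"
  shows "\<exists>m\<in>P. z \<le> m \<and> m \<le> c \<and> (\<forall>y\<in>P. y \<le> c \<longrightarrow> modulus n y \<le> modulus n m)"
proof -
  define S where "S = {m\<in>P. z \<le> m \<and> m \<le> c}"
  have "finite S" "S \<noteq> {}" using polymatroid_finite assms by (auto simp: S_def)
  then have "Max (modulus n ` S) \<in> modulus n ` S" by (intro Max_in) auto
  then obtain m where "m \<in> S" and max: "Max (modulus n ` S) = modulus n m" by blast
  have m: "modulus n y \<le> modulus n m" if "y \<in> S" for y
    unfolding max[symmetric] using \<open>finite S\<close> that by (intro Max_ge) auto
  from \<open>m \<in> S\<close> have mS: "m \<in> P" "z \<le> m" "m \<le> c" by (simp_all add: S_def)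
  have "modulus n y \<le> modulus n m" if y: "y \<in> P" "y \<le> c" for y
  proof (rule ccontr)
    assume "\<not> ?thesis"
    then have "modulus n m < modulus n y" by simp
    then obtain w where w: "w \<in> P" "m < w" "w \<le> sup m y"
      using polymatroid_exchange[of m y] mS y by blast
    have "w \<le> c" using w(3) mS(3) y(2) by (meson le_sup_iff order_trans sup_least)
    then have "w \<in> S" using mS w(1,2) by (simp add: S_def order.trans[OF _ less_imp_le])
    then have "modulus n w \<le> modulus n m" by (rule m)
    then show False
      using modulus_strict_mono[of m n w] w(2) polymatroid_support[OF w(1)] polymatroid_support[OF mS(1)]
      by simp
  qed
  then show ?thesis using mS by blast
qed

lemma modulus_eq_sum_support:
  assumes "\<And>i. i \<notin> A \<Longrightarrow> u i = 0" "A \<subseteq> {1..n}"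
  shows "modulus n u = sum u A"
  unfolding modulus_def using assms by (intro sum.mono_neutral_right) auto

text \<open>
  One member \<open>m\<close> of \<open>P\<close> attains the rank of \<open>A \<inter> B\<close> and of \<open>A \<union> B\<close> at once: extend a vector that attains
  the former, below its join with a vector that attains the latter. For \<open>m\<close> the inequality is the modular
  identity \<open>m(A \<union> B) + m(A \<inter> B) = m(A) + m(B)\<close>.
\<close>
lemma polymatroid_rank_submodular:
  assumes "A \<subseteq> {1..n}" "B \<subseteq> {1..n}"
  shows "polymatroid_rank P (A \<union> B) + polymatroid_rank P (A \<inter> B)
           \<le> polymatroid_rank P A + polymatroid_rank P B"
proof -
  have fin: "finite A" "finite B" using assms finite_subset by auto
  obtain v where v: "v \<in> P" "\<And>i. i \<notin> A \<inter> B \<Longrightarrow> v i = 0" "sum v (A \<inter> B) = polymatroid_rank P (A \<inter> B)"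
    using polymatroid_rank_attained[of "A \<inter> B"] fin by blast
  obtain y where y: "y \<in> P" "\<And>i. i \<notin> A \<union> B \<Longrightarrow> y i = 0" "sum y (A \<union> B) = polymatroid_rank P (A \<union> B)"
    using polymatroid_rank_attained[of "A \<union> B"] fin by blast
  obtain m where m: "m \<in> P" "v \<le> m" "m \<le> sup v y" "modulus n y \<le> modulus n m"
    using maximal_extension[of v "sup v y"] v y by auto
  have "m i = 0" if "i \<notin> A \<union> B" for i
    using m(3) v(2)[of i] y(2)[of i] that by (auto simp: le_fun_def dest: spec[of _ i])
  then have "modulus n m = sum m (A \<union> B)" by (rule modulus_eq_sum_support) (use assms in auto)
  moreover have "modulus n y = sum y (A \<union> B)"
    by (rule modulus_eq_sum_support) (use assms y in auto)
  ultimately have "polymatroid_rank P (A \<union> B) \<le> sum m (A \<union> B)" using m y by simp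
  moreover have "polymatroid_rank P (A \<inter> B) \<le> sum m (A \<inter> B)"
    using v(3) m(2) sum_mono[of "A \<inter> B" v m] by (auto simp: le_fun_def)
  moreover have "sum m (A \<union> B) + sum m (A \<inter> B) = sum m A + sum m B"
    using fin by (rule sum.union_inter)
  ultimately show ?thesis
    using sum_le_polymatroid_rank[OF m(1), of A] sum_le_polymatroid_rank[OF m(1), of B] by linarith
qed

lemma modulus_fun_upd_Suc:
  assumes "k \<in> {1..n}"
  shows "modulus n (v(k := Suc (v k))) = Suc (modulus n v)"
proof -
  have "sum (v(k := Suc (v k))) ({1..n} - {k}) = sum v ({1..n} - {k})"
    by (intro sum.cong) auto
  then show ?thesis
    unfolding modulus_def sum.remove[OF finite_atLeastAtMost assms] by simp
qed

lemma fun_upd_Suc_in_nonneg_vectors: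
  assumes "k \<in> {1..n}" "v \<in> nonneg_vectors n"
  shows "v(k := Suc (v k)) \<in> nonneg_vectors n"
  using assms by (auto simp: nonneg_vectors_def)

text \<open>
  The coordinates in which \<open>v\<close> cannot be increased form a set on which \<open>v\<close> attains the rank.
  Otherwise exchange raises the restriction of \<open>v\<close> to \<open>T\<close> in some \<open>k \<in> T\<close>. Extend the result to some
  \<open>z\<close> of largest modulus below \<open>c = v + e\<^sub>k\<close>. As \<open>c \<notin> P\<close>, the vector \<open>z\<close> has lost something against
  \<open>v\<close> in a coordinate \<open>l \<notin> T\<close>. But \<open>v + e\<^sub>l\<close> lies in \<open>P\<close> and has larger modulus than \<open>z\<close>, so exchange
  enlarges \<open>z\<close>, and the enlargement may be truncated at \<open>c\<close>: a contradiction.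
\<close>
lemma saturated_coordinates_tight:
  assumes v: "v \<in> P" and T: "T = {i \<in> {1..n}. v(i := Suc (v i)) \<notin> P}"
  shows "sum v T = polymatroid_rank P T"
proof (rule ccontr)
  assume "sum v T \<noteq> polymatroid_rank P T"
  then have lt: "sum v T < polymatroid_rank P T"
    using sum_le_polymatroid_rank[OF v, of T] by simp
  have T1: "T \<subseteq> {1..n}" and finT: "finite T" using T by auto
  obtain y where y: "y \<in> P" "\<And>i. i \<notin> T \<Longrightarrow> y i = 0" "sum y T = polymatroid_rank P T"
    using polymatroid_rank_attained[OF finT] by blast
  define vT where "vT = (\<lambda>i. if i \<in> T then v i else 0)"
  have vT: "vT \<in> P" using polymatroid_downward[OF v] by (auto simp: vT_def le_fun_def)
  have "modulus n vT = sum v T"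
    using modulus_eq_sum_support[of T vT] T1 by (simp add: vT_def cong: sum.cong)
  moreover have "modulus n y = sum y T" using modulus_eq_sum_support[of T y] T1 y by simp
  ultimately obtain w where w: "w \<in> P" "vT < w" "w \<le> sup vT y"
    using polymatroid_exchange[OF vT y(1)] lt y(3) by auto
  obtain k where k: "vT k < w k" using w(2) by (auto simp: fun_less_iff_nat)
  have kT: "k \<in> T"
  proof (rule ccontr)
    assume "k \<notin> T"
    then show False using k w(3) y(2)[of k] by (auto simp: le_fun_def vT_def dest: spec[of _ k])
  qed
  then have k1: "k \<in> {1..n}" using T1 by auto
  define c where "c = v(k := Suc (v k))"
  define x where "x = vT(k := Suc (v k))"
  have cP: "c \<notin> P" using kT T by (auto simp: c_def)
  have xP: "x \<in> P"
    using w(2) k kT by (intro polymatroid_downward[OF w(1)])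
      (auto simp: x_def vT_def le_fun_def fun_less_iff_nat dest: spec)
  have xc: "x \<le> c" by (auto simp: x_def c_def vT_def le_fun_def)
  have vc: "v \<le> c" by (auto simp: c_def le_fun_def)
  have c_nonneg: "c \<in> nonneg_vectors n"
    unfolding c_def using fun_upd_Suc_in_nonneg_vectors k1 v polymatroid_support by blast
  have mod_c: "modulus n c = Suc (modulus n v)" unfolding c_def by (rule modulus_fun_upd_Suc[OF k1])
  obtain z where z: "z \<in> P" "x \<le> z" "z \<le> c" "\<And>y. y \<in> P \<Longrightarrow> y \<le> c \<Longrightarrow> modulus n y \<le> modulus n z"
    using maximal_extension[OF xP xc] by blast
  have "z < c" using z cP by (metis order_le_imp_less_or_eq)
  then have zv: "modulus n z \<le> modulus n v"
    using modulus_strict_mono[of z n c] polymatroid_support[OF z(1)] c_nonneg mod_c by auto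
  have zk: "v k < z k" using z(2) by (auto simp: x_def le_fun_def dest: spec[of _ k])
  have "\<not> v \<le> z"
  proof
    assume "v \<le> z"
    then have "v < z" using zk by (auto simp: fun_less_iff_nat)
    then show False using modulus_strict_mono[of v n z] zv polymatroid_support v z(1) by auto
  qed
  then obtain l where l: "z l < v l" by (auto simp: le_fun_def not_le)
  have "l \<notin> T"
  proof
    assume "l \<in> T"
    then have "v l \<le> x l" by (auto simp: x_def vT_def)
    also have "\<dots> \<le> z l" using z(2) by (auto simp: le_fun_def)
    finally show False using l by simp
  qed
  moreover have l1: "l \<in> {1..n}"
    using l polymatroid_support[OF v] by (auto simp: nonneg_vectors_def)
  ultimately have y': "v(l := Suc (v l)) \<in> P" using T by auto
  have "modulus n z < modulus n (v(l := Suc (v l)))"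
    using zv modulus_fun_upd_Suc[OF l1, of v] by simp
  then obtain w' where w': "w' \<in> P" "z < w'" "w' \<le> sup z (v(l := Suc (v l)))"
    using polymatroid_exchange[OF z(1) y'] by blast
  obtain i where i: "z i < w' i" using w'(2) by (auto simp: fun_less_iff_nat)
  \<comment> \<open>The exchange may raise coordinate \<open>l\<close> up to \<open>v l + 1\<close>, which exceeds \<open>c\<close>. Truncation still leaves
    a proper enlargement: \<open>z l < v l\<close>, and in any other coordinate in which \<open>w'\<close> exceeds \<open>z\<close> it is at
    most \<open>v\<close>.\<close>
  have "inf w' c \<in> P" using polymatroid_downward[OF w'(1)] by simp
  moreover have "z < inf w' c"
  proof -
    have "z i < c i"
    proof (cases "i = l")
      case True
      then show ?thesis using l vc by (auto simp: le_fun_def intro: less_le_trans)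
    next
      case False
      have "w' i \<le> sup (z i) (v i)" using w'(3) False by (auto simp: le_fun_def dest: spec[of _ i])
      then have "z i < v i" using i by (auto simp: sup_nat_def max_def split: if_splits)
      then show ?thesis using vc by (auto simp: le_fun_def intro: less_le_trans)
    qed
    then have "z i < inf w' c i" using i by (simp add: inf_nat_def)
    moreover have "z \<le> inf w' c" using w'(2) z(3) by (simp add: less_imp_le)
    ultimately show ?thesis by (auto simp: fun_less_iff_nat)
  qed
  ultimately show False
    using z(4)[of "inf w' c"] modulus_strict_mono[of z n "inf w' c"] polymatroid_support z(1) by auto
qed

text \<open>
  The rank inequalities describe \<open>P\<close>: a largest member \<open>v \<le> u\<close> that differs from \<open>u\<close> would have a saturated
  coordinate with \<open>v k < u k\<close>, so that \<open>u\<close> would exceed the rank on the tight set of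
  saturated coordinates.
\<close>
lemma in_polymatroid_if_sum_le_rank:
  assumes u: "u \<in> nonneg_vectors n"
    and le: "\<And>A. A \<subseteq> {1..n} \<Longrightarrow> sum u A \<le> polymatroid_rank P A"
  shows "u \<in> P"
proof -
  have "(\<lambda>_. 0) \<in> P" using polymatroid_nonempty polymatroid_downward by (metis ex_in_conv le_funI zero_le)
  then obtain v where v: "v \<in> P" "v \<le> u" "\<And>y. y \<in> P \<Longrightarrow> y \<le> u \<Longrightarrow> modulus n y \<le> modulus n v"
    using maximal_extension[of "\<lambda>_. 0" u] by (auto simp: le_fun_def)
  define T where "T = {i \<in> {1..n}. v(i := Suc (v i)) \<notin> P}"
  have "v = u"
  proof (rule ccontr)
    assume "v \<noteq> u"
    then obtain k where k: "v k < u k" using v(2) by (metis fun_less_iff_nat order_le_imp_less_or_eq)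
    have k1: "k \<in> {1..n}" using k u by (auto simp: nonneg_vectors_def)
    have "v(k := Suc (v k)) \<le> u" using v(2) k by (auto simp: le_fun_def)
    then have "k \<in> T"
      using v(3)[of "v(k := Suc (v k))"] modulus_fun_upd_Suc[OF k1, of v] k1 by (auto simp: T_def)
    then have "sum v T < sum u T"
      using v(2) k by (intro sum_strict_mono_ex1) (auto simp: T_def le_fun_def)
    also have "\<dots> \<le> polymatroid_rank P T" by (rule le) (auto simp: T_def)
    finally show False using saturated_coordinates_tight[OF v(1) T_def] by simp
  qed
  then show ?thesis using v by simp
qed

text \<open>
  By exchange, all bases have the same modulus, namely the rank of the ground set.
\<close>
lemma bases_eq: "bases P = {u \<in> P. sum u {1..n} = polymatroid_rank P {1..n}}"
proof (intro equalityI subsetI)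
  fix u assume u: "u \<in> bases P"
  obtain y where y: "y \<in> P" "sum y {1..n} = polymatroid_rank P {1..n}"
    using polymatroid_rank_attained[of "{1..n}"] by auto
  have uP: "u \<in> P" using u by (simp add: bases_def)
  have "\<not> modulus n u < modulus n y"
  proof
    assume "modulus n u < modulus n y"
    then obtain w where "w \<in> P" "u < w" using polymatroid_exchange[OF uP y(1)] by blast
    then show False using u by (simp add: bases_def)
  qed
  then have "polymatroid_rank P {1..n} \<le> sum u {1..n}" using y(2) by (simp add: modulus_def)
  then show "u \<in> {u \<in> P. sum u {1..n} = polymatroid_rank P {1..n}}"
    using uP sum_le_polymatroid_rank[OF uP, of "{1..n}"] by simp
next
  fix u assume "u \<in> {u \<in> P. sum u {1..n} = polymatroid_rank P {1..n}}"
  then have u: "u \<in> P" "sum u {1..n} = polymatroid_rank P {1..n}" by simp_all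
  have False if v: "v \<in> P" "u < v" for v
  proof -
    have "sum u {1..n} < sum v {1..n}"
      using modulus_strict_mono[OF polymatroid_support polymatroid_support, OF u(1) v(1) v(2)]
      by (simp add: modulus_def)
    then show False using sum_le_polymatroid_rank[OF v(1), of "{1..n}"] u(2) by simp
  qed
  then show "u \<in> bases P" using u(1) unfolding bases_def by blast
qed

end

text \<open>
  The integer decomposition property: an integral vector in the \<open>(q + 1)\<close>-fold dilation of the base
  polytope is the sum of a base and an integral vector in the \<open>q\<close>-fold dilation. It is the
  decomposition of \<open>w\<close> along \<open>\<rho> + q\<rho>\<close>; equality on the ground set for \<open>w\<close> forces it for both summands.
\<close>
lemma base_split:
  assumes dp: "discrete_polymatroid n P" and w: "w \<in> nonneg_vectors n"
    and le: "\<And>A. A \<subseteq> {1..n} \<Longrightarrow> sum w A \<le> Suc q * polymatroid_rank P A"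
    and eq: "sum w {1..n} = Suc q * polymatroid_rank P {1..n}"
  shows "\<exists>u\<in>bases P. u \<le> w \<and>
           (\<forall>A\<subseteq>{1..n}. sum (\<lambda>i. w i - u i) A \<le> q * polymatroid_rank P A) \<and>
           sum (\<lambda>i. w i - u i) {1..n} = q * polymatroid_rank P {1..n}"
proof -
  let ?r = "polymatroid_rank P"
  define f where "f = (\<lambda>A. int (?r A))"
  define g where "g = (\<lambda>A. int q * int (?r A))"
  have fin: "finite A" if "A \<subseteq> {1..n}" for A using that finite_subset by blast
  have fmono: "f A \<le> f B" if "A \<subseteq> B" "B \<subseteq> {1..n}" for A B
    unfolding f_def using polymatroid_rank_mono[OF dp that(1)] fin that by simp
  have fsub: "f (A \<union> B) + f (A \<inter> B) \<le> f A + f B" if "A \<subseteq> {1..n}" "B \<subseteq> {1..n}" for A B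
    unfolding f_def using polymatroid_rank_submodular[OF dp that] by linarith
  have g: "g A = int q * f A" for A by (simp add: g_def f_def)
  have "\<exists>u. (\<forall>i\<in>{1..n}. 0 \<le> u i \<and> u i \<le> int (w i)) \<and>
             (\<forall>A\<subseteq>{1..n}. sum u A \<le> f A \<and> sum (\<lambda>i. int (w i) - u i) A \<le> g A)"
  proof (rule submodular_decomposition)
    show "f {} = 0" "g {} = 0" by (simp_all add: f_def g_def polymatroid_rank_empty[OF dp])
    show "g A \<le> g B" if "A \<subseteq> B" "B \<subseteq> {1..n}" for A B
      unfolding g using fmono[OF that] by (simp add: mult_left_mono)
    show "g (A \<union> B) + g (A \<inter> B) \<le> g A + g B" if "A \<subseteq> {1..n}" "B \<subseteq> {1..n}" for A B
      unfolding g using mult_left_mono[OF fsub[OF that], of "int q"] by (simp add: algebra_simps)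
    show "(\<Sum>i\<in>A. int (w i)) \<le> f A + g A" if "A \<subseteq> {1..n}" for A
    proof -
      have "int (sum w A) \<le> int (Suc q * ?r A)" using le[OF that] by (rule of_nat_mono)
      then show ?thesis by (simp add: f_def g_def algebra_simps)
    qed
  qed (use fmono fsub in auto)
  then obtain u where u: "\<And>i. i \<in> {1..n} \<Longrightarrow> 0 \<le> u i \<and> u i \<le> int (w i)"
    "\<And>A. A \<subseteq> {1..n} \<Longrightarrow> sum u A \<le> f A"
    "\<And>A. A \<subseteq> {1..n} \<Longrightarrow> sum (\<lambda>i. int (w i) - u i) A \<le> g A" by blast
  define v where "v = (\<lambda>i. if i \<in> {1..n} then nat (u i) else 0)"
  have v_u: "int (v i) = u i" if "i \<in> {1..n}" for i using u(1)[OF that] that by (simp add: v_def)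
  have vw: "v i \<le> w i" for i
    using u(1)[of i] by (cases "i \<in> {1..n}") (auto simp: v_def)
  have sum_v: "int (sum v A) = sum u A" if "A \<subseteq> {1..n}" for A
    unfolding of_nat_sum using that v_u by (intro sum.cong) auto
  have sum_wv: "int (sum (\<lambda>i. w i - v i) A) = sum (\<lambda>i. int (w i) - u i) A" if "A \<subseteq> {1..n}" for A
    unfolding of_nat_sum using that v_u vw by (intro sum.cong) (auto simp: of_nat_diff)
  have v_le: "sum v A \<le> ?r A" if "A \<subseteq> {1..n}" for A
    using u(2)[OF that, folded sum_v[OF that]] unfolding f_def by (simp only: of_nat_le_iff)
  have wv_le: "sum (\<lambda>i. w i - v i) A \<le> q * ?r A" if "A \<subseteq> {1..n}" for A
  proof -
    have "int (sum (\<lambda>i. w i - v i) A) \<le> int (q * ?r A)"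
      using u(3)[OF that, folded sum_wv[OF that]] by (simp only: g_def of_nat_mult)
    then show ?thesis by (simp only: of_nat_le_iff)
  qed
  have "sum v {1..n} + sum (\<lambda>i. w i - v i) {1..n} = sum w {1..n}"
    unfolding sum.distrib[symmetric] using vw by (intro sum.cong) auto
  then have eqs: "sum v {1..n} = ?r {1..n}" "sum (\<lambda>i. w i - v i) {1..n} = q * ?r {1..n}"
    using eq v_le[of "{1..n}"] wv_le[of "{1..n}"] by simp_all
  have "v \<in> P"
    by (rule in_polymatroid_if_sum_le_rank[OF dp _ v_le]) (auto simp: v_def nonneg_vectors_def)
  then have "v \<in> bases P" using eqs(1) by (simp add: bases_eq[OF dp])
  then show ?thesis using vw wv_le eqs(2) by (intro bexI[of _ v]) (auto simp: le_fun_def)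
qed

section \<open>Leading exponents\<close>

lemma poly_mapping_sum_single:
  fixes f :: "'a \<Rightarrow>\<^sub>0 'b::comm_monoid_add"
  shows "f = (\<Sum>k\<in>Poly_Mapping.keys f. Poly_Mapping.single k (Poly_Mapping.lookup f k))"
  by (rule poly_mapping_eqI)
    (auto simp: lookup_sum lookup_single when_def in_keys_iff if_distrib sum.delta)

definition lead_exp :: "('a::linorder \<Rightarrow>\<^sub>0 'b::zero) \<Rightarrow> 'a" where
  "lead_exp f = Max (Poly_Mapping.keys f)"

lemma keys_nonempty: "f \<noteq> 0 \<Longrightarrow> Poly_Mapping.keys f \<noteq> {}"
  by (metis ex_in_conv in_keys_iff lookup_zero poly_mapping_eqI)

lemma lead_exp_in_keys: "f \<noteq> 0 \<Longrightarrow> lead_exp f \<in> Poly_Mapping.keys f"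
  unfolding lead_exp_def by (intro Max_in finite_keys keys_nonempty)

lemma keys_le_lead_exp: "k \<in> Poly_Mapping.keys f \<Longrightarrow> k \<le> lead_exp f"
  unfolding lead_exp_def by (intro Max_ge finite_keys)

lemma lookup_mult_keys:
  fixes f g :: "'a::comm_monoid_add \<Rightarrow>\<^sub>0 'b::comm_semiring_0"
  shows "Poly_Mapping.lookup (f * g) k =
    (\<Sum>a\<in>Poly_Mapping.keys f. \<Sum>b\<in>Poly_Mapping.keys g.
       if a + b = k then Poly_Mapping.lookup f a * Poly_Mapping.lookup g b else 0)"
proof -
  have "f * g = (\<Sum>a\<in>Poly_Mapping.keys f. \<Sum>b\<in>Poly_Mapping.keys g.
      Poly_Mapping.single (a + b) (Poly_Mapping.lookup f a * Poly_Mapping.lookup g b))"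
    unfolding mult_single[symmetric] sum_product[symmetric] poly_mapping_sum_single[symmetric] ..
  then show ?thesis by (simp add: lookup_sum lookup_single when_def)
qed

text \<open>
  The lexicographic order on exponents is a monomial order: a nonzero exponent is positive, as its
  first nonzero entry decides.
\<close>
lemma zero_le_poly_mapping_nat: "(0 :: nat \<Rightarrow>\<^sub>0 nat) \<le> a"
proof transfer
  fix a :: "nat \<Rightarrow> nat"
  show "less_fun (\<lambda>_. 0) a \<or> (\<lambda>_. 0) = a"
  proof (cases "\<exists>k. a k \<noteq> 0")
    case True
    then obtain m where m: "a m \<noteq> 0" "\<And>k. k < m \<Longrightarrow> a k = 0"
      using exists_least_iff[of "\<lambda>k. a k \<noteq> 0"] by blast
    then have "less_fun (\<lambda>_. 0) a" by (intro less_funI exI[of _ m]) simp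
    then show ?thesis ..
  qed auto
qed

text \<open>
  Only one pair of exponents of \<open>f\<close> and \<open>g\<close> has the sum of the leading exponents as its sum, because
  the order is compatible with addition and cancellative.
\<close>
lemma
  fixes f g :: "'a::{ordered_cancel_comm_monoid_add,linorder} \<Rightarrow>\<^sub>0 'b::idom"
  assumes "f \<noteq> 0" "g \<noteq> 0"
  shows lookup_mult_lead: "Poly_Mapping.lookup (f * g) (lead_exp f + lead_exp g) =
           Poly_Mapping.lookup f (lead_exp f) * Poly_Mapping.lookup g (lead_exp g)" (is ?A)
    and lead_exp_mult: "lead_exp (f * g) = lead_exp f + lead_exp g" (is ?B)
proof -
  have *: "(if a + b = lead_exp f + lead_exp g then Poly_Mapping.lookup f a * Poly_Mapping.lookup g b else 0)
     = (if b = lead_exp g then if a = lead_exp f then Poly_Mapping.lookup f a * Poly_Mapping.lookup g b else 0 else 0)"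
    if "a \<in> Poly_Mapping.keys f" "b \<in> Poly_Mapping.keys g" for a b
  proof -
    have "a \<le> lead_exp f" "b \<le> lead_exp g" using that keys_le_lead_exp by auto
    then have "a + b = lead_exp f + lead_exp g \<longleftrightarrow> a = lead_exp f \<and> b = lead_exp g"
      by (metis add_less_le_mono add_le_less_mono order_le_imp_less_or_eq order_less_irrefl)
    then show ?thesis by auto
  qed
  show A: ?A
    unfolding lookup_mult_keys
    using lead_exp_in_keys[OF assms(1)] lead_exp_in_keys[OF assms(2)]
    by (simp add: * sum.delta cong: sum.cong)
  then have "lead_exp f + lead_exp g \<in> Poly_Mapping.keys (f * g)"
    using lead_exp_in_keys[OF assms(1)] lead_exp_in_keys[OF assms(2)] by (auto simp: in_keys_iff)
  moreover have "k \<le> lead_exp f + lead_exp g" if k: "k \<in> Poly_Mapping.keys (f * g)" for k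
  proof -
    obtain a b where "k = a + b" "a \<in> Poly_Mapping.keys f" "b \<in> Poly_Mapping.keys g"
      using k keys_mult[of f g] by blast
    then show ?thesis by (simp add: add_mono keys_le_lead_exp)
  qed
  ultimately show ?B unfolding lead_exp_def[of "f * g"] by (intro Max_eqI finite_keys) auto
qed

lemma lookup_lead_exp_power:
  fixes f :: "(nat \<Rightarrow>\<^sub>0 nat) \<Rightarrow>\<^sub>0 'b::idom"
  assumes "f \<noteq> 0"
  shows "Poly_Mapping.lookup (lead_exp (f ^ i)) k = i * Poly_Mapping.lookup (lead_exp f) k"
proof (induction i)
  case 0
  then show ?case by (simp add: lead_exp_def)
next
  case (Suc i)
  then show ?case using assms by (simp add: lead_exp_mult lookup_add)
qed

section \<open>Monoid algebras and almost integral elements\<close>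

text \<open>
  For a submonoid \<open>C\<close> of the exponents this is the monoid algebra \<open>K[C]\<close>, realised inside the polynomial ring.
\<close>
definition monoid_algebra :: "(nat \<Rightarrow>\<^sub>0 nat) set \<Rightarrow> 'k::field mpoly set" where
  "monoid_algebra C = {f. Poly_Mapping.keys f \<subseteq> C}"

locale exponent_monoid =
  fixes C :: "(nat \<Rightarrow>\<^sub>0 nat) set"
  assumes zero_closed: "0 \<in> C" and add_closed: "\<And>a b. a \<in> C \<Longrightarrow> b \<in> C \<Longrightarrow> a + b \<in> C"
begin

lemma monoid_algebra_0: "0 \<in> monoid_algebra C"
  by (simp add: monoid_algebra_def)

lemma monoid_algebra_single: "a \<in> C \<Longrightarrow> Poly_Mapping.single a c \<in> monoid_algebra C"
  by (simp add: monoid_algebra_def)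

lemma monoid_algebra_add: "f \<in> monoid_algebra C \<Longrightarrow> g \<in> monoid_algebra C \<Longrightarrow> f + g \<in> monoid_algebra C"
  using keys_add[of f g] by (auto simp: monoid_algebra_def)

lemma monoid_algebra_uminus: "f \<in> monoid_algebra C \<Longrightarrow> - f \<in> monoid_algebra C"
  by (auto simp: monoid_algebra_def in_keys_iff subset_iff)

lemma monoid_algebra_mult:
  assumes "f \<in> monoid_algebra C" "g \<in> monoid_algebra C"
  shows "f * g \<in> monoid_algebra C"
proof -
  have "{a + b | a b. a \<in> Poly_Mapping.keys f \<and> b \<in> Poly_Mapping.keys g} \<subseteq> C"
    using assms add_closed unfolding monoid_algebra_def by blast
  then show ?thesis using keys_mult[of f g] unfolding monoid_algebra_def by blast
qed

lemma monoid_algebra_1: "1 \<in> monoid_algebra C"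
  by (simp add: monoid_algebra_def zero_closed)

lemma monoid_algebra_power: "f \<in> monoid_algebra C \<Longrightarrow> f ^ i \<in> monoid_algebra C"
  by (induction i) (auto intro: monoid_algebra_mult monoid_algebra_1)

lemma monoid_algebra_sum: "(\<And>i. i \<in> I \<Longrightarrow> f i \<in> monoid_algebra C) \<Longrightarrow> sum f I \<in> monoid_algebra C"
  by (induction I rule: infinite_finite_induct) (auto intro: monoid_algebra_add monoid_algebra_0)

lemma monoid_algebra_of_nat: "of_nat m \<in> monoid_algebra C"
  by (induction m) (auto intro: monoid_algebra_add monoid_algebra_0 monoid_algebra_1)

text \<open>
  The fractions \<open>f / g\<close> all of whose powers have \<open>d\<close> as a common denominator are stable under
  translation by elements \<open>m\<close> of the ring, by the binomial theorem. The condition is written without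
  fractions, as \<open>d f\<^sup>i \<in> g\<^sup>i K[C]\<close>.
\<close>
lemma almost_integral_diff:
  fixes f g d m :: "'k::field mpoly"
  assumes alm: "\<And>i. \<exists>h\<in>monoid_algebra C. d * f ^ i = g ^ i * h"
    and m: "m \<in> monoid_algebra C"
  shows "\<exists>h\<in>monoid_algebra C. d * (f - m * g) ^ i = g ^ i * h"
proof -
  obtain h where h: "\<And>i. h i \<in> monoid_algebra C" "\<And>i. d * f ^ i = g ^ i * h i"
    using alm by metis
  define H where "H = (\<Sum>j\<le>i. of_nat (i choose j) * (h j * (- m) ^ (i - j)))"
  have "H \<in> monoid_algebra C"
    unfolding H_def using h(1) m
    by (intro monoid_algebra_sum monoid_algebra_mult monoid_algebra_of_nat monoid_algebra_power
        monoid_algebra_uminus)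
  moreover have "d * (f - m * g) ^ i = g ^ i * H"
  proof -
    have "f - m * g = f + (- m) * g" by simp
    then have "d * (f - m * g) ^ i = (\<Sum>j\<le>i. d * (of_nat (i choose j) * f ^ j * ((- m) * g) ^ (i - j)))"
      by (simp only: binomial_ring sum_distrib_left)
    also have "\<dots> = (\<Sum>j\<le>i. g ^ i * (of_nat (i choose j) * (h j * (- m) ^ (i - j))))"
    proof (rule sum.cong)
      fix j assume "j \<in> {..i}"
      then have gi: "g ^ i = g ^ j * g ^ (i - j)" by (simp add: power_add[symmetric])
      have "d * (of_nat (i choose j) * f ^ j * ((- m) * g) ^ (i - j))
              = (d * f ^ j) * (of_nat (i choose j) * ((- m) ^ (i - j) * g ^ (i - j)))"
        by (simp only: power_mult_distrib ac_simps)
      also have "\<dots> = g ^ i * (of_nat (i choose j) * (h j * (- m) ^ (i - j)))"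
        unfolding h(2) gi by (simp only: ac_simps)
      finally show "d * (of_nat (i choose j) * f ^ j * ((- m) * g) ^ (i - j))
              = g ^ i * (of_nat (i choose j) * (h j * (- m) ^ (i - j)))" .
    qed simp
    finally show ?thesis by (simp only: H_def sum_distrib_left)
  qed
  ultimately show ?thesis by blast
qed

text \<open>
  Comparing leading exponents in \<open>d f\<^sup>i = g\<^sup>i h\<^sub>i\<close> turns the condition on \<open>f / g\<close> into
  one on the exponents \<open>x\<close>, \<open>y\<close>, \<open>z\<close> of \<open>f\<close>, \<open>g\<close>, \<open>d\<close>: every \<open>z + i (x - y)\<close> is in \<open>C\<close>. By hypothesis \<open>x - y\<close> is in \<open>C\<close>, so a
  monomial \<open>m\<close> of the ring cancels the leading term of \<open>f\<close>: the fraction \<open>f / g - m\<close>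
  satisfies the same condition and has a smaller numerator. The process ends because only finitely many
  exponents in \<open>C\<close> lie below the first \<open>x - y\<close>. The hypothesis \<open>closed\<close> says that \<open>C\<close> is
  completely integrally closed; it is phrased without subtraction, which truncates on
  natural numbers.
\<close>
lemma almost_integral_quotient_in_monoid_algebra:
  fixes f g d :: "'k::field mpoly"
  assumes fin: "\<And>b. finite {a \<in> C. a \<le> b}"
    and closed: "\<And>x y z. x \<in> C \<Longrightarrow> y \<in> C \<Longrightarrow> z \<in> C \<Longrightarrow>
      (\<And>i. \<exists>w\<in>C. \<forall>k. Poly_Mapping.lookup z k + i * Poly_Mapping.lookup x k
                       = i * Poly_Mapping.lookup y k + Poly_Mapping.lookup w k) \<Longrightarrow>
      \<exists>w\<in>C. x = w + y"
    and d: "d \<in> monoid_algebra C" "d \<noteq> 0" and g: "g \<in> monoid_algebra C" "g \<noteq> 0"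
    and "f \<in> monoid_algebra C"
    and "\<And>i. \<exists>h\<in>monoid_algebra C. d * f ^ i = g ^ i * h"
  shows "\<exists>h\<in>monoid_algebra C. f = h * g"
  using assms(7,8)
\<comment> \<open>The measure counts the exponents that can still occur as the difference of the leading exponents;
  the successor separates \<open>f = 0\<close> from a numerator whose count has dropped to zero.\<close>
proof (induction "if f = 0 then 0 else Suc (card {a \<in> C. a + lead_exp g \<le> lead_exp f})"
    arbitrary: f rule: less_induct)
  case less
  show ?case
  proof (cases "f = 0")
    case True
    then show ?thesis using monoid_algebra_0 by (intro bexI[of _ 0]) auto
  next
    case False
    have in_C: "lead_exp h \<in> C" if "h \<in> monoid_algebra C" "h \<noteq> 0" for h :: "'k mpoly"
      using that lead_exp_in_keys by (auto simp: monoid_algebra_def)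
    have "\<exists>w\<in>C. lead_exp f = w + lead_exp g"
    proof (rule closed)
      show "lead_exp f \<in> C" "lead_exp g \<in> C" "lead_exp d \<in> C"
        using in_C less.prems(1) False g d by auto
      fix i
      obtain h where h: "h \<in> monoid_algebra C" "d * f ^ i = g ^ i * h" using less.prems(2) by blast
      have "d * f ^ i \<noteq> 0" using d False by simp
      then have "h \<noteq> 0" using h by auto
      have "lead_exp d + lead_exp (f ^ i) = lead_exp (g ^ i) + lead_exp h"
        using arg_cong[OF h(2), of lead_exp] d g False \<open>h \<noteq> 0\<close> by (simp add: lead_exp_mult)
      then have "Poly_Mapping.lookup (lead_exp d) k + i * Poly_Mapping.lookup (lead_exp f) k
                       = i * Poly_Mapping.lookup (lead_exp g) k + Poly_Mapping.lookup (lead_exp h) k" for k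
        using lookup_lead_exp_power[OF False, of i k] lookup_lead_exp_power[OF g(2), of i k]
        by (metis lookup_add)
      then show "\<exists>w\<in>C. \<forall>k. Poly_Mapping.lookup (lead_exp d) k + i * Poly_Mapping.lookup (lead_exp f) k
                       = i * Poly_Mapping.lookup (lead_exp g) k + Poly_Mapping.lookup w k"
        using in_C[OF h(1) \<open>h \<noteq> 0\<close>] by blast
    qed
    then obtain w where w: "w \<in> C" "lead_exp f = w + lead_exp g" by blast
    define c where "c = Poly_Mapping.lookup f (lead_exp f) / Poly_Mapping.lookup g (lead_exp g)"
    define m where "m = Poly_Mapping.single w c"
    have m: "m \<in> monoid_algebra C" unfolding m_def using w by (intro monoid_algebra_single)
    have lg: "Poly_Mapping.lookup g (lead_exp g) \<noteq> 0" "Poly_Mapping.lookup f (lead_exp f) \<noteq> 0"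
      using lead_exp_in_keys g False by (auto simp: in_keys_iff)
    have m0: "m \<noteq> 0" using lg unfolding m_def c_def
      by (metis divide_eq_0_iff lookup_single_eq lookup_zero)
    have lm: "lead_exp m = w" using m0 by (auto simp: m_def lead_exp_def)
    define f' where "f' = f - m * g"
    have f': "f' \<in> monoid_algebra C" unfolding f'_def diff_conv_add_uminus
      using m g less.prems(1) by (intro monoid_algebra_add monoid_algebra_uminus monoid_algebra_mult)
    have alm': "\<exists>h\<in>monoid_algebra C. d * f' ^ i = g ^ i * h" for i
      unfolding f'_def by (rule almost_integral_diff[OF less.prems(2) m])
    have coeff0: "Poly_Mapping.lookup f' (lead_exp f) = 0"
      using lookup_mult_lead[OF m0 g(2)] lg
      by (simp add: f'_def lookup_minus w(2) lm) (simp add: m_def c_def w(2))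
    have lt: "lead_exp f' < lead_exp f" if "f' \<noteq> 0"
    proof -
      have k: "lead_exp f' \<in> Poly_Mapping.keys f'" using lead_exp_in_keys[OF that] .
      then have "Poly_Mapping.lookup f (lead_exp f') \<noteq> 0 \<or> Poly_Mapping.lookup (m * g) (lead_exp f') \<noteq> 0"
        by (auto simp: f'_def in_keys_iff lookup_minus)
      then have "lead_exp f' \<le> lead_exp f"
        using keys_le_lead_exp[of "lead_exp f'" f] keys_le_lead_exp[of "lead_exp f'" "m * g"]
          lead_exp_mult[OF m0 g(2)] lm w(2) by (auto simp: in_keys_iff)
      then show ?thesis using coeff0 k by (metis in_keys_iff order_le_imp_less_or_eq)
    qed
    have "\<exists>h\<in>monoid_algebra C. f' = h * g"
    proof (rule less.hyps[OF _ f' alm'])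
      show "(if f' = 0 then 0 else Suc (card {a \<in> C. a + lead_exp g \<le> lead_exp f'}))
          < (if f = 0 then 0 else Suc (card {a \<in> C. a + lead_exp g \<le> lead_exp f}))"
      proof (cases "f' = 0")
        case True
        then show ?thesis using False by simp
      next
        case f'0: False
        have "{a \<in> C. a + lead_exp g \<le> lead_exp f'} \<subset> {a \<in> C. a + lead_exp g \<le> lead_exp f}"
        proof (rule psubsetI)
          show "{a \<in> C. a + lead_exp g \<le> lead_exp f'} \<subseteq> {a \<in> C. a + lead_exp g \<le> lead_exp f}"
            using lt[OF f'0] by (auto intro: order.trans less_imp_le)
          have "w \<in> {a \<in> C. a + lead_exp g \<le> lead_exp f}" using w by simp
          moreover have "w \<notin> {a \<in> C. a + lead_exp g \<le> lead_exp f'}"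
            using lt[OF f'0] unfolding w(2) by (auto simp only: mem_Collect_eq not_le[symmetric])
          ultimately show "{a \<in> C. a + lead_exp g \<le> lead_exp f'} \<noteq> {a \<in> C. a + lead_exp g \<le> lead_exp f}"
            by blast
        qed
        moreover have "finite {a \<in> C. a + lead_exp g \<le> lead_exp f}"
        proof (rule finite_subset[OF _ fin])
          have "a \<le> a + lead_exp g" for a
            using add_left_mono[OF zero_le_poly_mapping_nat, of a "lead_exp g"] by simp
          then show "{a \<in> C. a + lead_exp g \<le> lead_exp f} \<subseteq> {a \<in> C. a \<le> lead_exp f}"
            by (auto intro: order_trans)
        qed
        ultimately show ?thesis using False f'0 by (simp add: psubset_card_mono)
      qed
    qed
    then obtain h where h: "h \<in> monoid_algebra C" "f' = h * g" by blast
    have "f = (h + m) * g" using h(2) by (simp add: f'_def algebra_simps)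
    then show ?thesis using monoid_algebra_add[OF h(1) m] by blast
  qed
qed

end

section \<open>Normality of monoid algebras\<close>

lemma embed_fract_simps:
  "embed_fract (a + b) = embed_fract a + embed_fract b"
  "embed_fract (a * b) = embed_fract a * embed_fract b"
  "embed_fract (- a) = - embed_fract a"
  "embed_fract 0 = 0" "embed_fract 1 = 1"
  by (simp_all add: embed_fract_def Zero_fract_def One_fract_def)

lemma embed_fract_power: "embed_fract (a ^ i) = embed_fract a ^ i"
  by (induction i) (simp_all add: embed_fract_simps)

lemma embed_fract_sum: "embed_fract (sum f I) = (\<Sum>i\<in>I. embed_fract (f i))"
  by (induction I rule: infinite_finite_induct) (simp_all add: embed_fract_simps)

lemma embed_fract_inject: "embed_fract a = embed_fract b \<longleftrightarrow> a = b"
  by (simp add: embed_fract_def eq_fract)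

lemma Fract_mult_embed: "b \<noteq> 0 \<Longrightarrow> Fract a b * embed_fract b = embed_fract a"
  by (simp add: embed_fract_def eq_fract)

text \<open>
  An equation of integral dependence of degree \<open>N\<close> for \<open>x = f / g\<close> expresses every power of \<open>x\<close> through
  the powers below the \<open>N\<close>-th, for which \<open>g\<^sup>N\<close> is a common denominator.
\<close>
lemma integral_imp_almost_integral:
  fixes R :: "'a::idom set"
  assumes one: "1 \<in> R" and zero: "0 \<in> R"
    and add: "\<And>a b. a \<in> R \<Longrightarrow> b \<in> R \<Longrightarrow> a + b \<in> R"
    and neg: "\<And>a. a \<in> R \<Longrightarrow> - a \<in> R"
    and mult: "\<And>a b. a \<in> R \<Longrightarrow> b \<in> R \<Longrightarrow> a * b \<in> R"
    and f: "f \<in> R" and g: "g \<in> R" "g \<noteq> 0"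
    and int: "integral_over (embed_fract ` R) (Fract f g)"
  shows "\<exists>N. \<forall>i. \<exists>h\<in>R. g ^ N * f ^ i = g ^ i * h"
proof -
  have power: "a ^ i \<in> R" if "a \<in> R" for a i using that by (induction i) (auto intro: one mult)
  have sums: "(\<And>i. i \<in> I \<Longrightarrow> F i \<in> R) \<Longrightarrow> sum F I \<in> R" for F :: "nat \<Rightarrow> 'a" and I
    by (induction I rule: infinite_finite_induct) (auto intro: add zero)
  obtain p where p: "lead_coeff p = 1" "\<And>i. coeff p i \<in> embed_fract ` R" "poly p (Fract f g) = 0"
    using int unfolding integral_over_def by blast
  define x where "x = Fract f g"
  define N where "N = Polynomial.degree p"
  obtain c where c: "\<And>i. c i \<in> R" "\<And>i. coeff p i = embed_fract (c i)"
  proof -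
    have "\<exists>r. r \<in> R \<and> coeff p i = embed_fract r" for i using p(2)[of i] by blast
    then show ?thesis using that by metis
  qed
  have xg: "x * embed_fract g = embed_fract f" unfolding x_def by (rule Fract_mult_embed[OF g(2)])
  have xN: "x ^ N = - (\<Sum>j<N. embed_fract (c j) * x ^ j)"
  proof -
    have "0 = (\<Sum>j\<le>N. coeff p j * x ^ j)" using p(3) by (simp add: poly_altdef N_def x_def)
    also have "\<dots> = (\<Sum>j<N. coeff p j * x ^ j) + x ^ N"
      using p(1) by (simp add: lessThan_Suc_atMost[symmetric] N_def)
    finally show ?thesis by (simp add: c(2) eq_neg_iff_add_eq_0 add.commute)
  qed
  have main: "\<exists>h\<in>R. embed_fract (g ^ N) * x ^ i = embed_fract h" for i
  proof (induction i rule: less_induct)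
    case (less i)
    show ?case
    proof (cases "i < N")
      case True
      have "embed_fract (g ^ N) * x ^ i = embed_fract (g ^ (N - i)) * (x * embed_fract g) ^ i"
        using True by (simp add: embed_fract_power power_mult_distrib power_add[symmetric])
      also have "\<dots> = embed_fract (g ^ (N - i) * f ^ i)"
        unfolding xg by (simp add: embed_fract_simps embed_fract_power)
      finally show ?thesis using mult power f g by blast
    next
      case False
      have "\<exists>h. \<forall>j<N. h j \<in> R \<and> embed_fract (g ^ N) * x ^ (i - N + j) = embed_fract (h j)"
      proof -
        have "\<exists>h\<in>R. embed_fract (g ^ N) * x ^ (i - N + j) = embed_fract h" if "j < N" for j
          using less.IH[of "i - N + j"] that False by simp
        then show ?thesis by metis
      qed
      then obtain h where h: "\<And>j. j < N \<Longrightarrow> h j \<in> R"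
        "\<And>j. j < N \<Longrightarrow> embed_fract (g ^ N) * x ^ (i - N + j) = embed_fract (h j)" by blast
      have "embed_fract (g ^ N) * x ^ i = embed_fract (g ^ N) * (x ^ (i - N) * x ^ N)"
        using False by (simp add: power_add[symmetric])
      also have "\<dots> = - (\<Sum>j<N. embed_fract (c j) * (embed_fract (g ^ N) * x ^ (i - N + j)))"
        unfolding xN by (simp add: sum_distrib_left power_add ac_simps)
      also have "\<dots> = - (\<Sum>j<N. embed_fract (c j * h j))"
        using h(2) by (intro arg_cong[of _ _ uminus] sum.cong) (simp_all add: embed_fract_simps)
      also have "\<dots> = embed_fract (- (\<Sum>j<N. c j * h j))"
        by (simp add: embed_fract_simps embed_fract_sum)
      finally show ?thesis using neg sums[of "{..<N}" "\<lambda>j. c j * h j"] mult c(1) h(1) by blast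
    qed
  qed
  have "\<exists>h\<in>R. g ^ N * f ^ i = g ^ i * h" for i
  proof -
    obtain h where h: "h \<in> R" "embed_fract (g ^ N) * x ^ i = embed_fract h" using main by blast
    have "embed_fract (g ^ N * f ^ i) = embed_fract (g ^ N) * x ^ i * embed_fract (g ^ i)"
      unfolding embed_fract_simps embed_fract_power xg[symmetric] power_mult_distrib
      by (simp only: ac_simps)
    also have "\<dots> = embed_fract (g ^ i * h)" unfolding h(2) by (simp add: embed_fract_simps mult.commute)
    finally have "g ^ N * f ^ i = g ^ i * h" by (simp only: embed_fract_inject)
    then show ?thesis using h(1) by blast
  qed
  then show ?thesis by blast
qed

text \<open>
  Integral elements of the fraction field have powers with a common denominator, and
  such fractions lie in \<open>K[C]\<close> by the cancellation of leading terms.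
\<close>
lemma (in exponent_monoid) normal_domain_monoid_algebra:
  assumes fin: "\<And>b. finite {a \<in> C. a \<le> b}"
    and closed: "\<And>x y z. x \<in> C \<Longrightarrow> y \<in> C \<Longrightarrow> z \<in> C \<Longrightarrow>
      (\<And>i. \<exists>w\<in>C. \<forall>k. Poly_Mapping.lookup z k + i * Poly_Mapping.lookup x k
                       = i * Poly_Mapping.lookup y k + Poly_Mapping.lookup w k) \<Longrightarrow>
      \<exists>w\<in>C. x = w + y"
  shows "normal_domain (monoid_algebra C :: 'k::field mpoly set)"
  unfolding normal_domain_def
proof (intro ballI impI)
  fix x :: "'k mpoly fract"
  assume x: "x \<in> fraction_field_of (monoid_algebra C)"
    and int: "integral_over (embed_fract ` monoid_algebra C) x"
  obtain f g where fg: "f \<in> monoid_algebra C" "g \<in> monoid_algebra C" "g \<noteq> 0" "x = Fract f g"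
    using x unfolding fraction_field_of_def by blast
  obtain N where N: "\<And>i. \<exists>h\<in>monoid_algebra C. g ^ N * f ^ i = g ^ i * h"
    using integral_imp_almost_integral[OF monoid_algebra_1 monoid_algebra_0
        monoid_algebra_add monoid_algebra_uminus
        monoid_algebra_mult fg(1,2,3) int[unfolded fg(4)]] by blast
  have "\<exists>h\<in>monoid_algebra C. f = h * g"
  proof (rule almost_integral_quotient_in_monoid_algebra[OF fin])
    show "\<exists>w\<in>C. x = w + y" if "x \<in> C" "y \<in> C" "z \<in> C"
      "\<And>i. \<exists>w\<in>C. \<forall>k. Poly_Mapping.lookup z k + i * Poly_Mapping.lookup x k
                       = i * Poly_Mapping.lookup y k + Poly_Mapping.lookup w k" for x y z
      using that by (rule closed)
    show "g ^ N \<in> monoid_algebra C" using fg(2) by (rule monoid_algebra_power)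
    show "g ^ N \<noteq> 0" using fg(3) by simp
  qed (fact fg N)+
  then obtain h where h: "h \<in> monoid_algebra C" "f = h * g" by blast
  have "x = embed_fract h" using fg h by (simp add: embed_fract_def eq_fract)
  then show "x \<in> embed_fract ` monoid_algebra C" using h by blast
qed

section \<open>The base ring as a monoid algebra\<close>

text \<open>
  The lattice points of the cone over the base polytope, with the height stored in coordinate \<open>0\<close>, the
  exponent of \<open>s\<close>. Being given by inequalities, this set is visibly integrally closed; that it
  is generated by its points of height one is the content of the decomposition property.
\<close>
definition base_cone :: "nat \<Rightarrow> (nat \<Rightarrow> nat) set \<Rightarrow> (nat \<Rightarrow>\<^sub>0 nat) set" where
  "base_cone n P = {a. Poly_Mapping.keys a \<subseteq> {0..n} \<and>
     (\<forall>A\<subseteq>{1..n}. sum (Poly_Mapping.lookup a) A \<le> Poly_Mapping.lookup a 0 * polymatroid_rank P A) \<and>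
     sum (Poly_Mapping.lookup a) {1..n} = Poly_Mapping.lookup a 0 * polymatroid_rank P {1..n}}"

lemma lookup_base_cone_eq_0:
  assumes "a \<in> base_cone n P" "k \<notin> {0..n}"
  shows "Poly_Mapping.lookup a k = 0"
  using assms unfolding base_cone_def by (blast intro: not_in_keys_iff_lookup_eq_zero[THEN iffD1])

lemma zero_in_base_cone: "0 \<in> base_cone n P"
  by (simp add: base_cone_def)

lemma add_in_base_cone:
  assumes "a \<in> base_cone n P" "b \<in> base_cone n P"
  shows "a + b \<in> base_cone n P"
proof -
  have "Poly_Mapping.keys (a + b) \<subseteq> {0..n}"
    using assms keys_add[of a b] unfolding base_cone_def by blast
  then show ?thesis
    using assms by (simp add: base_cone_def lookup_add sum.distrib add_mono distrib_right)
qed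

interpretation base_cone: exponent_monoid "base_cone n P" for n P
  by unfold_locales (fact zero_in_base_cone, fact add_in_base_cone)

lemma lookup_0_mono:
  fixes a b :: "nat \<Rightarrow>\<^sub>0 nat"
  assumes "a \<le> b"
  shows "Poly_Mapping.lookup a 0 \<le> Poly_Mapping.lookup b 0"
  using assms
proof transfer
  fix a b :: "nat \<Rightarrow> nat"
  assume "less_fun a b \<or> a = b"
  then show "a 0 \<le> b 0"
  proof
    assume "less_fun a b"
    then obtain k where k: "a k < b k" "\<And>k'. k' < k \<Longrightarrow> a k' = b k'" by (auto elim: less_funE)
    then show ?thesis by (cases "k = 0") auto
  qed simp
qed

text \<open>
  Coordinate \<open>0\<close> is compared first in the lexicographic order, so the exponents below \<open>b\<close> have
  bounded height, and the height bounds all other coordinates.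
\<close>
lemma finite_base_cone_le: "finite {a \<in> base_cone n P. a \<le> b}"
proof (rule finite_imageD)
  define M where "M = Poly_Mapping.lookup b 0 * Suc (polymatroid_rank P {1..n})"
  have M: "Poly_Mapping.lookup a i \<le> M" if a: "a \<in> base_cone n P" "a \<le> b" and i: "i \<in> {0..n}" for a i
  proof -
    have a0: "Poly_Mapping.lookup a 0 \<le> Poly_Mapping.lookup b 0" using a(2) by (rule lookup_0_mono)
    show ?thesis
    proof (cases "i = 0")
      case True
      then show ?thesis using a0 by (simp add: M_def)
    next
      case False
      then have "Poly_Mapping.lookup a i \<le> sum (Poly_Mapping.lookup a) {1..n}"
        using i by (intro member_le_sum) auto
      also have "\<dots> = Poly_Mapping.lookup a 0 * polymatroid_rank P {1..n}"
        using a(1) by (simp add: base_cone_def)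
      also have "\<dots> \<le> M" unfolding M_def using a0 by (intro mult_le_mono) auto
      finally show ?thesis .
    qed
  qed
  have "Poly_Mapping.lookup ` {a \<in> base_cone n P. a \<le> b}
          \<subseteq> {f. \<forall>i. (i \<in> {0..n} \<longrightarrow> f i \<in> {0..M}) \<and> (i \<notin> {0..n} \<longrightarrow> f i = 0)}"
  proof (intro subsetI, elim imageE, clarify, intro conjI allI impI)
    fix a i assume a: "a \<in> base_cone n P" "a \<le> b"
    show "Poly_Mapping.lookup a i \<in> {0..M}" if "i \<in> {0..n}" using M[OF a that] by simp
    show "Poly_Mapping.lookup a i = 0" if "i \<notin> {0..n}"
      using a(1) that by (rule lookup_base_cone_eq_0)
  qed
  then show "finite (Poly_Mapping.lookup ` {a \<in> base_cone n P. a \<le> b})"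
    by (rule finite_subset) (intro finite_set_of_finite_funs finite_atLeastAtMost)
  show "inj_on Poly_Mapping.lookup {a \<in> base_cone n P. a \<le> b}"
    by (auto intro!: inj_onI poly_mapping_eqI)
qed

lemma le_if_multiples_le:
  fixes a b c d :: nat
  assumes "\<And>i. c + i * a \<le> d + i * b"
  shows "a \<le> b"
proof (rule ccontr)
  assume "\<not> a \<le> b"
  then have "Suc b \<le> a" by simp
  then have "Suc d * Suc b \<le> Suc d * a" by (rule mult_le_mono2)
  then show False using assms[of "Suc d"] by simp
qed

text \<open>
  Put \<open>w = x - y\<close>. A linear inequality that holds for \<open>z + i w\<close> for all \<open>i\<close> holds for \<open>w\<close>; this applies to the
  sign conditions and to the rank inequalities. The equation at full rank is linear and passes to the difference.
\<close>
lemma base_cone_completely_closed: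
  assumes x: "x \<in> base_cone n P" and y: "y \<in> base_cone n P" and z: "z \<in> base_cone n P"
    and mult: "\<And>i. \<exists>w\<in>base_cone n P. \<forall>k. Poly_Mapping.lookup z k + i * Poly_Mapping.lookup x k
                       = i * Poly_Mapping.lookup y k + Poly_Mapping.lookup w k"
  shows "\<exists>w\<in>base_cone n P. x = w + y"
proof -
  obtain W where W: "\<And>i. W i \<in> base_cone n P"
    "\<And>i k. Poly_Mapping.lookup z k + i * Poly_Mapping.lookup x k
              = i * Poly_Mapping.lookup y k + Poly_Mapping.lookup (W i) k"
    using mult by metis
  have yx: "Poly_Mapping.lookup y k \<le> Poly_Mapping.lookup x k" for k
    by (rule le_if_multiples_le[of 0 _ "Poly_Mapping.lookup z k"]) (simp add: W(2))
  define w where "w = x - y"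
  have xk: "Poly_Mapping.lookup x k = Poly_Mapping.lookup w k + Poly_Mapping.lookup y k" for k
    using yx[of k] by (simp add: w_def lookup_minus)
  then have xwy: "x = w + y" by (intro poly_mapping_eqI) (simp add: lookup_add)
  have Wk: "Poly_Mapping.lookup (W i) k = Poly_Mapping.lookup z k + i * Poly_Mapping.lookup w k" for i k
    using W(2)[of k i] by (simp add: xk distrib_left)
  have "Poly_Mapping.keys w \<subseteq> {0..n}"
  proof
    fix k assume "k \<in> Poly_Mapping.keys w"
    then have "k \<in> Poly_Mapping.keys x" by (simp add: in_keys_iff xk)
    then show "k \<in> {0..n}" using x unfolding base_cone_def by blast
  qed
  moreover have "sum (Poly_Mapping.lookup w) A \<le> Poly_Mapping.lookup w 0 * polymatroid_rank P A"
    if A: "A \<subseteq> {1..n}" for A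
  proof (rule le_if_multiples_le)
    fix i
    have "sum (Poly_Mapping.lookup (W i)) A \<le> Poly_Mapping.lookup (W i) 0 * polymatroid_rank P A"
      using W(1)[of i] A unfolding base_cone_def by blast
    then show "sum (Poly_Mapping.lookup z) A + i * sum (Poly_Mapping.lookup w) A
        \<le> Poly_Mapping.lookup z 0 * polymatroid_rank P A
           + i * (Poly_Mapping.lookup w 0 * polymatroid_rank P A)"
      by (simp add: Wk sum.distrib sum_distrib_left algebra_simps)
  qed
  moreover have "sum (Poly_Mapping.lookup w) {1..n} = Poly_Mapping.lookup w 0 * polymatroid_rank P {1..n}"
  proof -
    have "sum (Poly_Mapping.lookup x) {1..n} = Poly_Mapping.lookup x 0 * polymatroid_rank P {1..n}"
      "sum (Poly_Mapping.lookup y) {1..n} = Poly_Mapping.lookup y 0 * polymatroid_rank P {1..n}"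
      using x y by (simp_all add: base_cone_def)
    then show ?thesis by (simp add: xk sum.distrib distrib_right)
  qed
  ultimately have "w \<in> base_cone n P" by (simp add: base_cone_def)
  then show ?thesis using xwy by blast
qed

definition base_exp :: "nat \<Rightarrow> (nat \<Rightarrow> nat) \<Rightarrow> nat \<Rightarrow>\<^sub>0 nat" where
  "base_exp n u = (\<Sum>i=1..n. Poly_Mapping.single i (u i)) + Poly_Mapping.single 0 1"

lemma lookup_base_exp:
  "Poly_Mapping.lookup (base_exp n u) k = (if k = 0 then 1 else if k \<le> n then u k else 0)"
  by (auto simp: base_exp_def lookup_add lookup_sum lookup_single when_def)

lemma mvar_power: "(mvar i :: 'k::field mpoly) ^ m = Poly_Mapping.single (Poly_Mapping.single i m) 1"
  by (induction m) (simp_all add: mvar_def mult_single single_add[symmetric])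

lemma prod_single_one:
  "(\<Prod>i\<in>I. Poly_Mapping.single (e i) (1::'k::field)) = Poly_Mapping.single (\<Sum>i\<in>I. e i) 1"
  by (induction I rule: infinite_finite_induct) (simp_all add: mult_single)

lemma base_monomial_eq:
  "(\<Prod>i=1..n. mvar i ^ u i) * mvar 0 = (Poly_Mapping.single (base_exp n u) 1 :: 'k::field mpoly)"
  by (simp add: mvar_power prod_single_one base_exp_def) (simp add: mvar_def mult_single)

lemma base_exp_in_base_cone:
  assumes dp: "discrete_polymatroid n P" and u: "u \<in> bases P"
  shows "base_exp n u \<in> base_cone n P"
proof -
  have sums: "sum (Poly_Mapping.lookup (base_exp n u)) A = sum u A" if "A \<subseteq> {1..n}" for A
    using that by (intro sum.cong) (auto simp: lookup_base_exp)
  have "u \<in> P" "sum u {1..n} = polymatroid_rank P {1..n}" using u by (simp_all add: bases_eq[OF dp])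
  then have "sum (Poly_Mapping.lookup (base_exp n u)) A
      \<le> Poly_Mapping.lookup (base_exp n u) 0 * polymatroid_rank P A" if "A \<subseteq> {1..n}" for A
    using sums[OF that] sum_le_polymatroid_rank[OF dp, of u A] by (simp add: lookup_base_exp)
  moreover have "sum (Poly_Mapping.lookup (base_exp n u)) {1..n}
      = Poly_Mapping.lookup (base_exp n u) 0 * polymatroid_rank P {1..n}"
    using sums[of "{1..n}"] \<open>sum u {1..n} = _\<close> by (simp add: lookup_base_exp)
  moreover have "Poly_Mapping.keys (base_exp n u) \<subseteq> {0..n}"
    by (auto simp: in_keys_iff lookup_base_exp split: if_splits)
  ultimately show ?thesis unfolding base_cone_def by blast
qed

lemma base_ring_subset_monoid_algebra:
  assumes dp: "discrete_polymatroid n P"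
  shows "(base_ring n (bases P) :: 'k::field mpoly set) \<subseteq> monoid_algebra (base_cone n P)"
proof
  fix f :: "'k mpoly"
  assume "f \<in> base_ring n (bases P)"
  then show "f \<in> monoid_algebra (base_cone n P)"
    unfolding base_ring_def
  proof induction
    case (const c)
    show ?case
      unfolding mconst_def by (rule base_cone.monoid_algebra_single[OF zero_in_base_cone])
  next
    case (gen g)
    then obtain u where "u \<in> bases P" "g = Poly_Mapping.single (base_exp n u) 1"
      unfolding base_monomial_eq by blast
    then show ?case
      using base_cone.monoid_algebra_single[OF base_exp_in_base_cone[OF dp]] by blast
  next
    case (add f g)
    then show ?case by (intro base_cone.monoid_algebra_add)
  next
    case (mult f g)
    then show ?case by (intro base_cone.monoid_algebra_mult)
  qed
qed

text \<open>
  Bases are split off one at a time, by induction on the height.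
\<close>
lemma monomial_in_base_ring:
  assumes dp: "discrete_polymatroid n P"
    and "a \<in> base_cone n P"
  shows "Poly_Mapping.single a 1 \<in> (base_ring n (bases P) :: 'k::field mpoly set)"
  using assms(2)
proof (induction "Poly_Mapping.lookup a 0" arbitrary: a)
  case 0
  have a0: "Poly_Mapping.lookup a 0 = 0" using 0(1) by (rule sym)
  have "Poly_Mapping.lookup a k = 0" for k
  proof (cases "k \<in> {1..n}")
    case True
    have "sum (Poly_Mapping.lookup a) {1..n} = 0" using 0(2) a0 by (simp add: base_cone_def)
    then show ?thesis using True by simp
  next
    case False
    then show ?thesis using a0 lookup_base_cone_eq_0[OF 0(2), of k] by (cases "k = 0") auto
  qed
  then have "a = 0" by (intro poly_mapping_eqI) simp
  then show ?case
    unfolding base_ring_def using subalgebra_generated.const[of 1] by (simp add: mconst_def)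
next
  case (Suc q)
  define w where "w = (\<lambda>i. if i = 0 then 0 else Poly_Mapping.lookup a i)"
  have keys: "Poly_Mapping.lookup a k = 0" if "k \<notin> {0..n}" for k
    using Suc.prems that by (rule lookup_base_cone_eq_0)
  have sum_w: "sum w A = sum (Poly_Mapping.lookup a) A" if "A \<subseteq> {1..n}" for A
    using that by (intro sum.cong) (auto simp: w_def)
  have "\<exists>u\<in>bases P. u \<le> w \<and>
           (\<forall>A\<subseteq>{1..n}. sum (\<lambda>i. w i - u i) A \<le> q * polymatroid_rank P A) \<and>
           sum (\<lambda>i. w i - u i) {1..n} = q * polymatroid_rank P {1..n}"
  proof (rule base_split[OF dp])
    show "w \<in> nonneg_vectors n" using keys by (auto simp: nonneg_vectors_def w_def)
    show "sum w A \<le> Suc q * polymatroid_rank P A" if "A \<subseteq> {1..n}" for A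
      unfolding Suc.hyps(2) sum_w[OF that] using Suc.prems that unfolding base_cone_def by blast
    show "sum w {1..n} = Suc q * polymatroid_rank P {1..n}"
      unfolding Suc.hyps(2) sum_w[OF subset_refl] using Suc.prems unfolding base_cone_def by blast
  qed
  then obtain u where u: "u \<in> bases P" "u \<le> w"
    "\<And>A. A \<subseteq> {1..n} \<Longrightarrow> sum (\<lambda>i. w i - u i) A \<le> q * polymatroid_rank P A"
    "sum (\<lambda>i. w i - u i) {1..n} = q * polymatroid_rank P {1..n}" by blast
  define b where "b = a - base_exp n u"
  have u0: "u k = 0" if "k \<notin> {1..n}" for k
    using le_funD[OF u(2), of k] keys[of k] that by (cases "k = 0") (auto simp: w_def)
  have le: "Poly_Mapping.lookup (base_exp n u) k \<le> Poly_Mapping.lookup a k" for k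
    using le_funD[OF u(2), of k] Suc.hyps(2) by (auto simp: lookup_base_exp w_def)
  have ab: "a = b + base_exp n u"
    using le by (intro poly_mapping_eqI) (simp add: b_def lookup_add lookup_minus)
  have bk: "Poly_Mapping.lookup b k = (if k = 0 then q else w k - u k)" for k
    using Suc.hyps(2) u0[of k] by (auto simp: b_def lookup_minus lookup_base_exp w_def)
  have sum_b: "sum (Poly_Mapping.lookup b) A = sum (\<lambda>i. w i - u i) A" if "A \<subseteq> {1..n}" for A
    using that by (intro sum.cong) (auto simp: bk)
  have "b \<in> base_cone n P"
    unfolding base_cone_def
  proof (intro CollectI conjI allI impI)
    show "Poly_Mapping.keys b \<subseteq> {0..n}"
    proof
      fix k assume "k \<in> Poly_Mapping.keys b"
      then have "Poly_Mapping.lookup a k \<noteq> 0" by (simp add: ab lookup_add in_keys_iff)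
      then show "k \<in> {0..n}" using keys[of k] by argo
    qed
    show "sum (Poly_Mapping.lookup b) A \<le> Poly_Mapping.lookup b 0 * polymatroid_rank P A"
      if "A \<subseteq> {1..n}" for A unfolding sum_b[OF that] using u(3)[OF that] by (simp add: bk)
    show "sum (Poly_Mapping.lookup b) {1..n} = Poly_Mapping.lookup b 0 * polymatroid_rank P {1..n}"
      unfolding sum_b[OF subset_refl] using u(4) by (simp add: bk)
  qed
  moreover have "q = Poly_Mapping.lookup b 0" by (simp add: bk)
  ultimately have "Poly_Mapping.single b 1 \<in> (base_ring n (bases P) :: 'k mpoly set)"
    by (intro Suc.hyps(1))
  moreover have "Poly_Mapping.single (base_exp n u) 1 \<in> (base_ring n (bases P) :: 'k mpoly set)"
    unfolding base_ring_def base_monomial_eq using u(1) by (intro subalgebra_generated.gen imageI)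
  ultimately have "Poly_Mapping.single b 1 * Poly_Mapping.single (base_exp n u) 1
      \<in> (base_ring n (bases P) :: 'k mpoly set)"
    unfolding base_ring_def by (rule subalgebra_generated.mult)
  then show ?case by (simp add: mult_single ab)
qed

lemma base_ring_eq_monoid_algebra:
  assumes dp: "discrete_polymatroid n P"
  shows "(base_ring n (bases P) :: 'k::field mpoly set) = monoid_algebra (base_cone n P)"
proof (rule equalityI[OF base_ring_subset_monoid_algebra[OF dp]], rule subsetI)
  fix f :: "'k mpoly"
  assume f: "f \<in> monoid_algebra (base_cone n P)"
  have sums: "(\<And>i. i \<in> I \<Longrightarrow> F i \<in> base_ring n (bases P)) \<Longrightarrow> sum F I \<in> base_ring n (bases P)"
    for F :: "(nat \<Rightarrow>\<^sub>0 nat) \<Rightarrow> 'k mpoly" and I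
    using subalgebra_generated.const[of 0] unfolding base_ring_def
    by (induction I rule: infinite_finite_induct)
      (auto intro: subalgebra_generated.add simp: mconst_def)
  have "Poly_Mapping.single a (Poly_Mapping.lookup f a) \<in> base_ring n (bases P)"
    if "a \<in> Poly_Mapping.keys f" for a
  proof -
    have "Poly_Mapping.single a (1::'k) \<in> base_ring n (bases P)"
      using monomial_in_base_ring[OF dp] f that unfolding monoid_algebra_def by blast
    then have "mconst (Poly_Mapping.lookup f a) * Poly_Mapping.single a 1 \<in> base_ring n (bases P)"
      unfolding base_ring_def by (intro subalgebra_generated.mult subalgebra_generated.const)
    then show ?thesis by (simp add: mconst_def mult_single)
  qed
  then have "(\<Sum>a\<in>Poly_Mapping.keys f. Poly_Mapping.single a (Poly_Mapping.lookup f a))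
      \<in> base_ring n (bases P)" by (rule sums)
  then show "f \<in> base_ring n (bases P)" by (simp only: poly_mapping_sum_single[symmetric])
qed

theorem corollary6p2:
  fixes n :: nat and P B :: "(nat \<Rightarrow> nat) set"
  assumes "discrete_polymatroid n P"
    and "B = bases P"
  shows "normal_domain (base_ring n B :: 'k::field mpoly set)"
  unfolding assms(2) base_ring_eq_monoid_algebra[OF assms(1)]
proof (rule base_cone.normal_domain_monoid_algebra[OF finite_base_cone_le])
  show "\<exists>w\<in>base_cone n P. x = w + y"
    if "x \<in> base_cone n P" "y \<in> base_cone n P" "z \<in> base_cone n P"
      "\<And>i. \<exists>w\<in>base_cone n P. \<forall>k. Poly_Mapping.lookup z k + i * Poly_Mapping.lookup x k
                       = i * Poly_Mapping.lookup y k + Poly_Mapping.lookup w k" for x y z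
    using that by (rule base_cone_completely_closed)
qed

end
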